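(* Let $p\ge2$ be an integer and $a>1$. Let $\mathcal{X}$ be a polynomial vector field on $S_{p,1}$ such that $\mathcal{X}$ has only finitely many invariant algebraic sets, and let $m=\deg\mathcal{X}$. Then the maximum number of invariant parallels for $\mathcal{X}$ is $m-1$ (that is, $\mathcal{X}$ has at most $m-1$ invariant parallels). Moreover, there is a polynomial vector field of degree $m$ on $S_{p,1}$ with exactly $m-1$ invariant parallels in $S_{p,1}$.
   Context: $S_{p,1}\subset\mathbb{R}^{p+2}$ is the hypersurface $\{h=0\}$, where $h=\left(\sum_{i=1}^{p+1}x_i^2-a^2\right)^2+x_{p+2}^2-1$. A polynomial vector field $\mathcal{X}=(R_1,\ldots,R_{p+2})=\sum_iR_i\,\partial/\partial x_i$ has degree $\max_i\deg R_i$ and is a vector field on $S_{p,1}$ if $\mathcal{X}h=Kh$ for some $K\in\mathbb{R}[x_1,\ldots,x_{p+2}]$. An invariant algebraic set of $\mathcal{X}$ is the zero set of a polynomial $f$ with $\mathcal{X}f=Kf$ for some polynomial $K$. A parallel on $S_{p,1}$ is the intersection of $S_{p,1}$ with a hyperplane $\{a_{p+2}x_{p+2}-c=0\}$, $a_{p+2}\in\mathbb{R}$, $c\in(0,1)$; it is invariant for $\mathcal{X}$ if $\mathcal{X}(a_{p+2}x_{p+2}-c)=K(a_{p+2}x_{p+2}-c)$ for some $K\in\mathbb{R}[x_1,\ldots,x_{p+2}]$. Here each such intersection counts as one parallel (its connected components are not counted separately). Counting convention: only hypersurfaces of finite multiplicity are considered, and they are counted with multiplicity, where the multiplicity of $\{g=0\}$,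 $g=a_{p+2}x_{p+2}-c$, is the largest $\mu$ with $g^\mu\mid R_{p+2}$ (defined only if $R_{p+2}\neq0$). *)

theory Defs
  imports Complex_Main "HOL-Library.Poly_Mapping" "HOL-Library.FuncSet"
begin

text \<open>
  Real polynomials in the variables \<open>x\<^sub>0, x\<^sub>1, x\<^sub>2, \<dots>\<close>: finitely supported maps from
  monomials (exponent vectors) to coefficients.  The ring \<open>\<real>[x\<^sub>1,\<dots>,x\<^sub>n]\<close> is the subset
  \<open>polys n\<close>.
\<close>

type_synonym mpoly = "(nat \<Rightarrow>\<^sub>0 nat) \<Rightarrow>\<^sub>0 real"

definition Var :: "nat \<Rightarrow> mpoly" where
  "Var i = Poly_Mapping.single (Poly_Mapping.single i 1) 1"

definition Const :: "real \<Rightarrow> mpoly" where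
  "Const c = Poly_Mapping.single 0 c"

definition polys :: "nat \<Rightarrow> mpoly set" where
  "polys n = {f. \<forall>t \<in> Poly_Mapping.keys f. Poly_Mapping.keys t \<subseteq> {1..n}}"

definition eval_mpoly :: "(nat \<Rightarrow> real) \<Rightarrow> mpoly \<Rightarrow> real" where
  "eval_mpoly x f =
     (\<Sum>t \<in> Poly_Mapping.keys f.
        Poly_Mapping.lookup f t * (\<Prod>i \<in> Poly_Mapping.keys t. x i ^ Poly_Mapping.lookup t i))"

text \<open>The zero polynomial gets total degree 0.\<close>

definition tdeg :: "mpoly \<Rightarrow> nat" where
  "tdeg f =
     Max (insert 0 ((\<lambda>t. \<Sum>i \<in> Poly_Mapping.keys t. Poly_Mapping.lookup t i) ` Poly_Mapping.keys f))"

text \<open>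
  Subtraction of monomials truncates, but then the exponent of the variable in
  \<open>t\<close>, and with it the coefficient, is zero.
\<close>

definition partial :: "nat \<Rightarrow> mpoly \<Rightarrow> mpoly" where
  "partial i f =
     (\<Sum>t \<in> Poly_Mapping.keys f.
        Poly_Mapping.single (t - Poly_Mapping.single i 1)
          (Poly_Mapping.lookup f t * real (Poly_Mapping.lookup t i)))"

text \<open>Points of \<open>\<real>\<^sup>n\<close> are the functions on \<open>{1..n}\<close>, extended by \<open>undefined\<close>.\<close>

definition zero_set :: "nat \<Rightarrow> mpoly \<Rightarrow> (nat \<Rightarrow> real) set" where
  "zero_set n f = {x \<in> {1..n} \<rightarrow>\<^sub>E UNIV. eval_mpoly x f = 0}"


section \<open>Polynomial vector fields on \<open>\<real>\<^sup>n\<close>\<close>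

text \<open>
  A vector field on \<open>\<real>\<^sup>n\<close> is given by its components \<open>R 1, \<dots>, R n\<close>; the values of
  \<open>R\<close> at other indices are irrelevant.
\<close>

definition poly_vf :: "nat \<Rightarrow> (nat \<Rightarrow> mpoly) \<Rightarrow> bool" where
  "poly_vf n R \<longleftrightarrow> (\<forall>i \<in> {1..n}. R i \<in> polys n)"

definition vf_degree :: "nat \<Rightarrow> (nat \<Rightarrow> mpoly) \<Rightarrow> nat" where
  "vf_degree n R = Max ((\<lambda>i. tdeg (R i)) ` {1..n})"

definition vf_apply :: "nat \<Rightarrow> (nat \<Rightarrow> mpoly) \<Rightarrow> mpoly \<Rightarrow> mpoly" where
  "vf_apply n R f = (\<Sum>i = 1..n. R i * partial i f)"

definition invariant_poly :: "nat \<Rightarrow> (nat \<Rightarrow> mpoly) \<Rightarrow> mpoly \<Rightarrow> bool" where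
  "invariant_poly n R f \<longleftrightarrow> (\<exists>K \<in> polys n. vf_apply n R f = K * f)"

definition invariant_algebraic_sets :: "nat \<Rightarrow> (nat \<Rightarrow> mpoly) \<Rightarrow> (nat \<Rightarrow> real) set set" where
  "invariant_algebraic_sets n R = {zero_set n f | f. f \<in> polys n \<and> invariant_poly n R f}"


section \<open>The hypersurface \<open>S\<^bsub>p,1\<^esub>\<close> and its parallels\<close>

definition S_poly :: "nat \<Rightarrow> real \<Rightarrow> mpoly" where
  "S_poly p a = ((\<Sum>i = 1..p + 1. Var i ^ 2) - Const (a ^ 2)) ^ 2 + Var (p + 2) ^ 2 - 1"

definition S_surface :: "nat \<Rightarrow> real \<Rightarrow> (nat \<Rightarrow> real) set" where
  "S_surface p a = zero_set (p + 2) (S_poly p a)"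

definition vf_on_S :: "nat \<Rightarrow> real \<Rightarrow> (nat \<Rightarrow> mpoly) \<Rightarrow> bool" where
  "vf_on_S p a R \<longleftrightarrow> poly_vf (p + 2) R \<and> invariant_poly (p + 2) R (S_poly p a)"

definition par_poly :: "nat \<Rightarrow> real \<Rightarrow> real \<Rightarrow> mpoly" where
  "par_poly p \<alpha> c = Const \<alpha> * Var (p + 2) - Const c"

definition parallel :: "nat \<Rightarrow> real \<Rightarrow> (nat \<Rightarrow> real) set \<Rightarrow> (nat \<Rightarrow> real) set" where
  "parallel p a H = S_surface p a \<inter> H"

text \<open>
  The exponents \<open>\<mu>\<close> with \<open>g\<^sup>\<mu> dvd R\<^bsub>p+2\<^esub>\<close>.  The multiplicity of \<open>g\<close> is the largest one;
  it is undefined (infinite) iff the set is infinite, which is so for every \<open>g\<close> when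
  \<open>R\<^bsub>p+2\<^esub> = 0\<close>, and for the constant \<open>g = -c\<close> (the case \<open>\<alpha> = 0\<close>).
\<close>

definition par_exponents :: "nat \<Rightarrow> (nat \<Rightarrow> mpoly) \<Rightarrow> mpoly \<Rightarrow> nat set" where
  "par_exponents p R g = {\<mu>. g ^ \<mu> dvd R (p + 2)}"

definition finite_mult :: "nat \<Rightarrow> (nat \<Rightarrow> mpoly) \<Rightarrow> mpoly \<Rightarrow> bool" where
  "finite_mult p R g \<longleftrightarrow> finite (par_exponents p R g)"

definition par_mult :: "nat \<Rightarrow> (nat \<Rightarrow> mpoly) \<Rightarrow> mpoly \<Rightarrow> nat" where
  "par_mult p R g = Max (par_exponents p R g)"

text \<open>
  The invariant parallels of finite multiplicity, as a set in which a parallel of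
  multiplicity \<open>\<mu>\<close> occurs \<open>\<mu>\<close> times, so that its cardinality is the number of invariant
  parallels counted with multiplicity.  A parallel is represented by the hyperplane \<open>H\<close>
  (a set of points) that cuts it out: proportional pairs \<open>(\<alpha>, c)\<close> give the same \<open>H\<close> and
  are not counted separately, and distinct hyperplanes meeting the hypersurface cut out
  distinct parallels.
\<close>

definition invariant_parallels :: "nat \<Rightarrow> (nat \<Rightarrow> mpoly) \<Rightarrow> ((nat \<Rightarrow> real) set \<times> nat) set" where
  "invariant_parallels p R =
     {(H, k). \<exists>\<alpha> c. 0 < c \<and> c < 1 \<and> H = zero_set (p + 2) (par_poly p \<alpha> c)
        \<and> invariant_poly (p + 2) R (par_poly p \<alpha> c)
        \<and> finite_mult p R (par_poly p \<alpha> c)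
        \<and> k < par_mult p R (par_poly p \<alpha> c)}"

end

theory Submission
  imports Defs "HOL-Computational_Algebra.Polynomial"
begin

text \<open>
Write \<open>z\<close> for the last coordinate, \<open>s\<close> for the sum of the squares of the others and
\<open>h = (s - a\<^sup>2)\<^sup>2 + z\<^sup>2 - 1\<close>.  Let \<open>R\<close> be the component of a vector field \<open>X\<close> along \<open>z\<close>.
Tangency reads \<open>2 (s - a\<^sup>2) X(s) + 2 z R = K h\<close>, and \<open>X(s)\<close> vanishes on the axis \<open>s = 0\<close>
because it is twice the sum of the products \<open>x\<^sub>i R\<^sub>i\<close>.

Upper bound (\<open>sum_multiplicities_less_tdeg\<close>).  A parallel of multiplicity \<open>\<mu>\<close> in the
plane \<open>z = d\<close> means \<open>(z - d)\<^sup>\<mu>\<close> divides \<open>R\<close>.  On every line that is parametrized by \<open>z\<close>,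
the restriction of \<open>R\<close> then has a zero of order at least \<open>\<mu>\<close> at \<open>d\<close>, so the multiplicities
add up to at most the degree of \<open>R\<close>.  One more unit must be saved, and the axis provides it.
On the axis, \<open>2 z R = K (z\<^sup>2 + a\<^sup>4 - 1)\<close>, and the last factor has no real zeros since \<open>a > 1\<close>.
If \<open>R\<close> is not zero on the axis, then the heights \<open>d \<noteq> 0\<close> are zeros of \<open>K\<close> there, with
multiplicity, and \<open>K\<close> has one degree less than \<open>R\<close>.  If \<open>R\<close> vanishes on the axis, then a line through a point with \<open>R \<noteq> 0\<close> that
meets the axis at a fresh height gives \<open>R\<close> an additional zero on that line.

Sharpness.  The field with \<open>R\<^sub>1 = z (z - 1)\<^sup>k (s - a\<^sup>2) / 2\<close>, \<open>R = (z - 1)\<^sup>k (z\<^sup>2 - 1) x\<^sub>1\<close>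
and all other components zero has degree \<open>k + 3\<close>, is tangent to the hypersurface with
\<open>K = 2 z (z - 1)\<^sup>k x\<^sub>1\<close>, and has the parallel in \<open>z = 1\<close> with multiplicity \<open>k + 1\<close> and the one
in \<open>z = -1\<close> with multiplicity one.

This covers the degrees from three on, and no other degree occurs: if \<open>X\<close> has degree at
most two, then comparing coefficients in planes that contain the axis
(\<open>planar_quadratic_cofactor\<close>) gives \<open>2 X(s) = K s\<close>.  Hence \<open>h / s\<^sup>2\<close> is a rational first
integral, all members of the pencil \<open>h - \<lambda> s\<^sup>2\<close> are invariant, and \<open>X\<close> has infinitely many
invariant algebraic sets (\<open>low_degree_infinitely_many_invariant_sets\<close>).
\<close>

section \<open>Real polynomials as functions\<close>

abbreviation "keys \<equiv> Poly_Mapping.keys"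
abbreviation "lookup \<equiv> Poly_Mapping.lookup"
abbreviation "single \<equiv> Poly_Mapping.single"

lemma poly_mapping_sum_single: "(\<Sum>t\<in>keys f. single t (lookup f t)) = f"
  by (rule poly_mapping_eqI)
     (simp add: lookup_sum lookup_single when_def sum.delta in_keys_iff)

lemma mpoly_induct [case_names single add]:
  fixes f :: mpoly
  assumes single: "\<And>t c. P (single t c)"
    and add: "\<And>f g. P f \<Longrightarrow> P g \<Longrightarrow> P (f + g)"
  shows "P f"
proof -
  have "P (\<Sum>t\<in>A. single t (lookup f t))" if "finite A" for A
    using that
  proof induction
    case empty
    show ?case using single[of 0 0] by simp
  qed (simp add: single add)
  from this[of "keys f"] show ?thesis by (simp add: poly_mapping_sum_single)
qed

definition monomial_value :: "(nat \<Rightarrow> real) \<Rightarrow> (nat \<Rightarrow>\<^sub>0 nat) \<Rightarrow> real" where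
  "monomial_value x t = (\<Prod>i\<in>keys t. x i ^ lookup t i)"

lemma monomial_value_superset:
  assumes "finite A" "keys t \<subseteq> A"
  shows "monomial_value x t = (\<Prod>i\<in>A. x i ^ lookup t i)"
  unfolding monomial_value_def
  by (rule prod.mono_neutral_left) (use assms in \<open>auto simp: in_keys_iff\<close>)

lemma monomial_value_add: "monomial_value x (s + t) = monomial_value x s * monomial_value x t"
proof -
  let ?A = "keys s \<union> keys t"
  have "keys (s + t) \<subseteq> ?A" by (rule keys_add)
  then show ?thesis
    by (simp add: monomial_value_superset[of ?A] lookup_add power_add prod.distrib)
qed

lemma eval_mpoly_superset:
  assumes "finite A" "keys f \<subseteq> A"
  shows "eval_mpoly x f = (\<Sum>t\<in>A. lookup f t * monomial_value x t)"
  unfolding eval_mpoly_def monomial_value_def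
  by (rule sum.mono_neutral_left) (use assms in \<open>auto simp: in_keys_iff\<close>)

lemma eval_mpoly_single [simp]: "eval_mpoly x (single t c) = c * monomial_value x t"
  by (subst eval_mpoly_superset[of "{t}"]) auto

lemma eval_mpoly_0 [simp]: "eval_mpoly x 0 = 0"
  by (simp add: eval_mpoly_def)

lemma eval_mpoly_add [simp]: "eval_mpoly x (f + g) = eval_mpoly x f + eval_mpoly x g"
proof -
  let ?A = "keys f \<union> keys g"
  have "keys (f + g) \<subseteq> ?A" by (rule keys_add)
  then show ?thesis
    by (simp add: eval_mpoly_superset[of ?A] lookup_add algebra_simps sum.distrib)
qed

lemma eval_mpoly_uminus [simp]: "eval_mpoly x (- f) = - eval_mpoly x f"
  using eval_mpoly_add[of x f "- f"] by simp

lemma eval_mpoly_diff [simp]: "eval_mpoly x (f - g) = eval_mpoly x f - eval_mpoly x g"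
  using eval_mpoly_add[of x f "- g"] by simp

lemma eval_mpoly_sum [simp]: "eval_mpoly x (sum F A) = (\<Sum>i\<in>A. eval_mpoly x (F i))"
  by (induction A rule: infinite_finite_induct) auto

lemma eval_mpoly_mult [simp]: "eval_mpoly x (f * g) = eval_mpoly x f * eval_mpoly x g"
proof (induction f rule: mpoly_induct)
  case (single s c)
  show ?case
    by (induction g rule: mpoly_induct)
       (simp_all add: mult_single monomial_value_add algebra_simps)
qed (simp add: algebra_simps)

lemma eval_mpoly_1 [simp]: "eval_mpoly x 1 = 1"
  using eval_mpoly_single[of x 0 1] by (simp add: monomial_value_def)

lemma eval_mpoly_power [simp]: "eval_mpoly x (f ^ k) = eval_mpoly x f ^ k"
  by (induction k) auto

lemma eval_mpoly_Const [simp]: "eval_mpoly x (Const c) = c"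
  by (simp add: Const_def monomial_value_def)

lemma eval_mpoly_Var [simp]: "eval_mpoly x (Var i) = x i"
  by (simp add: Var_def monomial_value_def)

text \<open>
This makes the substitution \<open>x\<^sub>i = \<tau> ^ (N ^ i)\<close> below injective on a finite set of
monomials.
\<close>

lemma digits_unique:
  fixes f g :: "nat \<Rightarrow> nat"
  assumes "\<And>i. i < L \<Longrightarrow> f i < N" "\<And>i. i < L \<Longrightarrow> g i < N"
    and "(\<Sum>i<L. f i * N ^ i) = (\<Sum>i<L. g i * N ^ i)" and "i < L"
  shows "f i = g i"
  using assms
proof (induction L arbitrary: f g i)
  case (Suc L)
  have peel: "(\<Sum>i<Suc L. h i * N ^ i) = h 0 + N * (\<Sum>i<L. h (Suc i) * N ^ i)" for h :: "nat \<Rightarrow> nat"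
    by (subst sum.lessThan_Suc_shift) (simp add: sum_distrib_left algebra_simps)
  let ?F = "\<Sum>i<L. f (Suc i) * N ^ i" and ?G = "\<Sum>i<L. g (Suc i) * N ^ i"
  have eq: "f 0 + N * ?F = g 0 + N * ?G"
    using Suc.prems(3) by (simp add: peel del: sum.lessThan_Suc)
  have lt: "f 0 < N" "g 0 < N" using Suc.prems by auto
  have "f 0 = g 0"
    using arg_cong[OF eq, of "\<lambda>k. k mod N"] lt by simp
  moreover from this have "?F = ?G" using eq lt by simp
  ultimately show ?case
    using Suc.IH[of "\<lambda>i. f (Suc i)" "\<lambda>i. g (Suc i)" "i - 1"] Suc.prems
    by (cases i) auto
qed simp

text \<open>
Kronecker substitution: with \<open>N\<close> larger than all exponents, \<open>x\<^sub>i = \<tau> ^ (N ^ i)\<close> turns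
distinct monomials into distinct powers of \<open>\<tau>\<close>, so the coefficients survive in a
univariate polynomial, which is zero if all its values are.
\<close>

lemma eval_mpoly_eq_0_imp_eq_0:
  assumes "\<And>x. eval_mpoly x f = 0"
  shows "f = 0"
proof (rule ccontr)
  assume "f \<noteq> 0"
  then obtain t0 where t0: "t0 \<in> keys f" by (metis poly_mapping_sum_single sum.empty all_not_in_conv)
  obtain L where L: "\<And>t i. t \<in> keys f \<Longrightarrow> i \<in> keys t \<Longrightarrow> i < L"
  proof -
    have "finite (\<Union>t\<in>keys f. keys t)" by simp
    then obtain k where "\<forall>i\<in>(\<Union>t\<in>keys f. keys t). i < k"
      using finite_nat_set_iff_bounded by blast
    with that show ?thesis by blast
  qed
  obtain N where N: "\<And>t i. t \<in> keys f \<Longrightarrow> i < L \<Longrightarrow> lookup t i < N"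
  proof -
    have "finite ((\<lambda>(t, i). lookup t i) ` (keys f \<times> {..<L}))" by simp
    then obtain k where "\<forall>j\<in>((\<lambda>(t, i). lookup t i) ` (keys f \<times> {..<L})). j < k"
      using finite_nat_set_iff_bounded by blast
    with that show ?thesis by blast
  qed
  define w where "w t = (\<Sum>i<L. lookup t i * N ^ i)" for t :: "nat \<Rightarrow>\<^sub>0 nat"
  have inj: "t = t'" if "t \<in> keys f" "t' \<in> keys f" "w t = w t'" for t t'
  proof (rule poly_mapping_eqI)
    fix i
    show "lookup t i = lookup t' i"
    proof (cases "i < L")
      case True
      then show ?thesis
        using digits_unique[of L "lookup t" N "lookup t'" i] that N unfolding w_def by blast
    next
      case False
      then show ?thesis using L[of t i] L[of t' i] that by (metis in_keys_iff)
    qed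
  qed
  define q where "q = (\<Sum>t\<in>keys f. monom (lookup f t) (w t))"
  have "poly q \<tau> = eval_mpoly (\<lambda>i. \<tau> ^ (N ^ i)) f" for \<tau>
  proof -
    have "monomial_value (\<lambda>i. \<tau> ^ (N ^ i)) t = \<tau> ^ w t" if "t \<in> keys f" for t
    proof -
      have "keys t \<subseteq> {..<L}" using L that by auto
      then have "monomial_value (\<lambda>i. \<tau> ^ (N ^ i)) t = (\<Prod>i<L. (\<tau> ^ (N ^ i)) ^ lookup t i)"
        by (simp add: monomial_value_superset)
      also have "\<dots> = \<tau> ^ w t"
        by (simp add: w_def power_sum mult.commute flip: power_mult)
      finally show ?thesis .
    qed
    then show ?thesis
      by (simp add: q_def poly_sum poly_monom eval_mpoly_superset[of "keys f"])
  qed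
  then have "q = 0" using assms by (simp flip: poly_all_0_iff_0)
  moreover have "coeff q (w t0) = lookup f t0"
  proof -
    have "coeff q (w t0) = (\<Sum>t\<in>keys f. if t = t0 then lookup f t else 0)"
      unfolding q_def coeff_sum by (rule sum.cong) (use inj t0 in auto)
    then show ?thesis using t0 by simp
  qed
  ultimately show False using t0 by (simp add: in_keys_iff)
qed

text \<open>
Identities in the polynomial ring can therefore be checked as identities of real numbers.
\<close>

lemma mpoly_eqI:
  assumes "\<And>x. eval_mpoly x f = eval_mpoly x g"
  shows "f = g"
  using eval_mpoly_eq_0_imp_eq_0[of "f - g"] assms by simp

section \<open>Restriction to lines\<close>

definition line_poly :: "(nat \<Rightarrow> real) \<Rightarrow> (nat \<Rightarrow> real) \<Rightarrow> mpoly \<Rightarrow> real poly" where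
  "line_poly u v f = (\<Sum>t\<in>keys f. smult (lookup f t) (\<Prod>i\<in>keys t. [:u i, v i:] ^ lookup t i))"

lemma poly_line_poly: "poly (line_poly u v f) r = eval_mpoly (\<lambda>i. u i + r * v i) f"
  by (simp add: line_poly_def eval_mpoly_def poly_sum poly_prod)

lemma line_poly_mult [simp]: "line_poly u v (f * g) = line_poly u v f * line_poly u v g"
  by (simp add: poly_eq_poly_eq_iff[symmetric] fun_eq_iff poly_line_poly)

lemma line_poly_power [simp]: "line_poly u v (f ^ k) = line_poly u v f ^ k"
  by (simp add: poly_eq_poly_eq_iff[symmetric] fun_eq_iff poly_line_poly)

section \<open>Total degree\<close>

lemma monomial_le_tdeg: "t \<in> keys f \<Longrightarrow> (\<Sum>i\<in>keys t. lookup t i) \<le> tdeg f"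
  unfolding tdeg_def by (rule Max_ge) auto

lemma tdeg_leI:
  assumes "\<And>t. t \<in> keys f \<Longrightarrow> (\<Sum>i\<in>keys t. lookup t i) \<le> d"
  shows "tdeg f \<le> d"
  unfolding tdeg_def by (subst Max_le_iff) (use assms in auto)

text \<open>
The link between total degree and zero counting: restricted to a line, a polynomial is
univariate of no larger degree.
\<close>

lemma degree_line_poly: "degree (line_poly u v f) \<le> tdeg f"
  unfolding line_poly_def
proof (rule degree_sum_le)
  fix t assume t: "t \<in> keys f"
  have "degree (\<Prod>i\<in>keys t. [:u i, v i:] ^ lookup t i) \<le> (\<Sum>i\<in>keys t. degree ([:u i, v i:] ^ lookup t i))"
    by (rule order.trans[OF degree_prod_sum_le]) (auto simp: o_def)
  also have "\<dots> \<le> (\<Sum>i\<in>keys t. lookup t i)"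
    by (intro sum_mono order.trans[OF degree_power_le]) auto
  also have "\<dots> \<le> tdeg f" using t by (rule monomial_le_tdeg)
  finally show "degree (smult (lookup f t) (\<Prod>i\<in>keys t. [:u i, v i:] ^ lookup t i)) \<le> tdeg f"
    by (rule order.trans[OF degree_smult_le])
qed simp

lemma monomial_degree_add:
  fixes s t :: "nat \<Rightarrow>\<^sub>0 nat"
  shows "(\<Sum>i\<in>keys (s + t). lookup (s + t) i) = (\<Sum>i\<in>keys s. lookup s i) + (\<Sum>i\<in>keys t. lookup t i)"
proof -
  let ?A = "keys s \<union> keys t"
  have sup: "(\<Sum>i\<in>keys r. lookup r i) = (\<Sum>i\<in>?A. lookup r i)" if "keys r \<subseteq> ?A" for r :: "nat \<Rightarrow>\<^sub>0 nat"
    by (rule sum.mono_neutral_left) (use that in \<open>auto simp: in_keys_iff\<close>)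
  show ?thesis
    unfolding sup[OF keys_add] sup[of s, OF Un_upper1] sup[of t, OF Un_upper2]
    by (simp add: lookup_add sum.distrib)
qed

lemma tdeg_mult_le: "tdeg (f * g) \<le> tdeg f + tdeg g"
proof (rule tdeg_leI)
  fix t assume "t \<in> keys (f * g)"
  then obtain r s where "t = r + s" "r \<in> keys f" "s \<in> keys g"
    using keys_mult[of f g] by auto
  then show "(\<Sum>i\<in>keys t. lookup t i) \<le> tdeg f + tdeg g"
    by (simp add: monomial_degree_add add_mono monomial_le_tdeg)
qed

lemma tdeg_add_le: "tdeg f \<le> d \<Longrightarrow> tdeg g \<le> d \<Longrightarrow> tdeg (f + g) \<le> d"
  using keys_add[of f g] by (intro tdeg_leI) (meson Un_iff in_mono monomial_le_tdeg order_trans)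

lemma tdeg_0 [simp]: "tdeg 0 = 0"
  by (simp add: tdeg_def)

lemma tdeg_uminus [simp]: "tdeg (- f) = tdeg f"
  by (simp add: tdeg_def in_keys_iff keys_def)

lemma tdeg_diff_le: "tdeg f \<le> d \<Longrightarrow> tdeg g \<le> d \<Longrightarrow> tdeg (f - g) \<le> d"
  using tdeg_add_le[of f d "- g"] by simp

lemma tdeg_Const [simp]: "tdeg (Const c) = 0"
  by (simp add: tdeg_def Const_def)

lemma tdeg_1 [simp]: "tdeg 1 = 0"
  by (simp add: tdeg_def)

lemma tdeg_Var [simp]: "tdeg (Var i) = 1"
  by (simp add: tdeg_def Var_def)

lemma tdeg_power_le: "tdeg (f ^ k) \<le> k * tdeg f"
proof (induction k)
  case (Suc k)
  then show ?case using tdeg_mult_le[of f "f ^ k"] by simp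
qed simp

lemma tdeg_sum_le: "(\<And>i. i \<in> A \<Longrightarrow> tdeg (F i) \<le> d) \<Longrightarrow> tdeg (sum F A) \<le> d"
  by (induction A rule: infinite_finite_induct) (auto intro: tdeg_add_le)

section \<open>Vector fields as derivations\<close>

lemma partial_superset:
  assumes "finite A" "keys f \<subseteq> A"
  shows "partial i f = (\<Sum>t\<in>A. single (t - single i 1) (lookup f t * real (lookup t i)))"
  unfolding partial_def
  by (rule sum.mono_neutral_left) (use assms in \<open>auto simp: in_keys_iff\<close>)

lemma partial_single: "partial i (single t c) = single (t - single i 1) (c * real (lookup t i))"
  by (subst partial_superset[of "{t}"]) auto

lemma partial_add [simp]: "partial i (f + g) = partial i f + partial i g"
proof -
  let ?A = "keys f \<union> keys g"
  have "keys (f + g) \<subseteq> ?A" by (rule keys_add)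
  then show ?thesis
    by (simp add: partial_superset[of ?A] lookup_add distrib_right single_add sum.distrib)
qed

lemma partial_0 [simp]: "partial i 0 = 0"
  by (simp add: partial_def)

lemma partial_uminus [simp]: "partial i (- f) = - partial i f"
  using partial_add[of i f "- f"] by (simp add: eq_neg_iff_add_eq_0 add.commute)

lemma partial_diff [simp]: "partial i (f - g) = partial i f - partial i g"
  using partial_add[of i f "- g"] by simp

text \<open>
The Leibniz rule on monomials.  Where the truncated subtraction \<open>t - single i 1\<close> is not
the inverse of adding \<open>single i 1\<close>, the factor \<open>lookup t i\<close> is zero.
\<close>

lemma partial_mult_single:
  "partial i (single s c * single t d) = single s c * partial i (single t d) + single t d * partial i (single s c)"
proof -
  have shift: "(s + t) - single i 1 = s + (t - single i 1)" if "lookup t i \<noteq> 0"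
    for s t :: "nat \<Rightarrow>\<^sub>0 nat"
    using that by (intro poly_mapping_eqI) (auto simp: lookup_add lookup_minus lookup_single when_def)
  have *: "single (s + t - single i 1) (c * d * real (lookup t i))
         = single s c * single (t - single i 1) (d * real (lookup t i))" for s t c and d :: real
    by (cases "lookup t i = 0") (simp_all add: mult_single shift mult.assoc flip: One_nat_def)
  show ?thesis
    using *[of s t c d] *[of t s d c]
    by (simp add: mult_single partial_single lookup_add algebra_simps single_add)
qed

lemma partial_mult [simp]: "partial i (f * g) = f * partial i g + g * partial i f"
proof (induction f rule: mpoly_induct)
  case (single s c)
  show ?case
    by (induction g rule: mpoly_induct) (simp_all add: partial_mult_single algebra_simps)
qed (simp add: algebra_simps)

lemma partial_Const [simp]: "partial i (Const c) = 0"
  by (simp add: Const_def partial_single)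

lemma partial_Var: "partial i (Var j) = (if i = j then 1 else 0)"
  by (simp add: Var_def partial_single lookup_single)

lemma polys_0 [intro]: "0 \<in> polys n" and polys_1 [intro]: "1 \<in> polys n"
  and polys_Const [intro]: "Const c \<in> polys n"
  by (auto simp: polys_def Const_def)

lemma polys_Var [intro]: "i \<in> {1..n} \<Longrightarrow> Var i \<in> polys n"
  by (auto simp: polys_def Var_def)

lemma polys_add [intro]: "f \<in> polys n \<Longrightarrow> g \<in> polys n \<Longrightarrow> f + g \<in> polys n"
  using keys_add[of f g] unfolding polys_def by blast

lemma polys_uminus [intro]: "f \<in> polys n \<Longrightarrow> - f \<in> polys n"
  by (auto simp: polys_def in_keys_iff)

lemma polys_diff [intro]: "f \<in> polys n \<Longrightarrow> g \<in> polys n \<Longrightarrow> f - g \<in> polys n"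
  using polys_add[of f n "- g"] by auto

lemma polys_mult [intro]:
  assumes "f \<in> polys n" "g \<in> polys n"
  shows "f * g \<in> polys n"
  unfolding polys_def
proof safe
  fix t i assume "t \<in> keys (f * g)" and i: "i \<in> keys t"
  then obtain r s where "t = r + s" "r \<in> keys f" "s \<in> keys g"
    using keys_mult[of f g] by auto
  then show "i \<in> {1..n}" using i assms keys_add[of r s] unfolding polys_def by blast
qed

lemma polys_power [intro]: "f \<in> polys n \<Longrightarrow> f ^ k \<in> polys n"
  by (induction k) auto

lemma polys_sum [intro]: "(\<And>i. i \<in> A \<Longrightarrow> F i \<in> polys n) \<Longrightarrow> sum F A \<in> polys n"
  by (induction A rule: infinite_finite_induct) auto

lemma vf_apply_add [simp]: "vf_apply n R (f + g) = vf_apply n R f + vf_apply n R g"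
  and vf_apply_diff [simp]: "vf_apply n R (f - g) = vf_apply n R f - vf_apply n R g"
  and vf_apply_mult [simp]: "vf_apply n R (f * g) = f * vf_apply n R g + g * vf_apply n R f"
  and vf_apply_Const [simp]: "vf_apply n R (Const c) = 0"
  and vf_apply_0 [simp]: "vf_apply n R 0 = 0"
  by (simp_all add: vf_apply_def algebra_simps sum.distrib sum_subtractf sum_distrib_left)

lemma Const_1: "Const 1 = 1"
  by (simp add: Const_def)

lemma vf_apply_1 [simp]: "vf_apply n R 1 = 0"
  using vf_apply_Const[of n R 1] by (simp add: Const_1)

lemma vf_apply_sum [simp]: "vf_apply n R (sum F A) = (\<Sum>i\<in>A. vf_apply n R (F i))"
  by (induction A rule: infinite_finite_induct) auto

lemma vf_apply_power2: "vf_apply n R (f ^ 2) = 2 * f * vf_apply n R f"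
  by (simp add: power2_eq_square algebra_simps)

lemma vf_apply_Var: "j \<in> {1..n} \<Longrightarrow> vf_apply n R (Var j) = R j"
  by (simp add: vf_apply_def partial_Var if_distrib[of "\<lambda>x. _ * x"] sum.delta cong: if_cong)

definition radius_sq :: "nat \<Rightarrow> mpoly" where
  "radius_sq p = (\<Sum>i = 1..p + 1. Var i ^ 2)"

lemma eval_radius_sq: "eval_mpoly x (radius_sq p) = (\<Sum>i = 1..p + 1. x i ^ 2)"
  by (simp add: radius_sq_def)

lemma S_poly_radius_sq: "S_poly p a = (radius_sq p - Const (a ^ 2)) ^ 2 + Var (p + 2) ^ 2 - 1"
  by (simp add: S_poly_def radius_sq_def)

lemma radius_sq_polys: "radius_sq p \<in> polys (p + 2)"
  unfolding radius_sq_def by (intro polys_sum polys_power polys_Var) auto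

lemma eval_S_poly: "eval_mpoly x (S_poly p a) = ((\<Sum>i = 1..p + 1. x i ^ 2) - a ^ 2) ^ 2 + x (p + 2) ^ 2 - 1"
  by (simp add: S_poly_radius_sq eval_radius_sq)

lemma vf_apply_radius_sq: "vf_apply (p + 2) R (radius_sq p) = 2 * (\<Sum>i = 1..p + 1. Var i * R i)"
proof -
  have "vf_apply (p + 2) R (radius_sq p) = (\<Sum>i = 1..p + 1. 2 * Var i * R i)"
    unfolding radius_sq_def vf_apply_sum
    by (rule sum.cong) (simp_all add: vf_apply_power2 vf_apply_Var)
  then show ?thesis by (simp add: sum_distrib_left mult.assoc)
qed

lemma vf_apply_S_poly:
  "vf_apply (p + 2) R (S_poly p a) =
     2 * (radius_sq p - Const (a ^ 2)) * vf_apply (p + 2) R (radius_sq p) + 2 * Var (p + 2) * R (p + 2)"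
  by (simp add: S_poly_radius_sq vf_apply_power2 vf_apply_Var)

lemma eval_vf_apply_S_poly:
  "eval_mpoly x (vf_apply (p + 2) R (S_poly p a)) =
     4 * ((\<Sum>i = 1..p + 1. x i ^ 2) - a ^ 2) * (\<Sum>i = 1..p + 1. x i * eval_mpoly x (R i))
     + 2 * x (p + 2) * eval_mpoly x (R (p + 2))"
proof -
  have two: "eval_mpoly x 2 = 2"
    using eval_mpoly_add[of x 1 1] by simp
  show ?thesis
    unfolding vf_apply_S_poly vf_apply_radius_sq
    by (simp add: two eval_radius_sq del: sum.cl_ivl_Suc)
qed

lemma invariant_polyE:
  assumes "invariant_poly n R f"
  obtains K where "K \<in> polys n" "vf_apply n R f = K * f"
  using assms by (auto simp: invariant_poly_def)

lemma tdeg_le_vf_degree: "i \<in> {1..n} \<Longrightarrow> tdeg (R i) \<le> vf_degree n R"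
  unfolding vf_degree_def by (rule Max_ge) auto

section \<open>Vector fields of degree at most two\<close>

text \<open>
The polynomial functions of degree at most two in the plane, with the coefficients spelled
out so that they can be compared.
\<close>

definition quadratic :: "(real \<Rightarrow> real \<Rightarrow> real) \<Rightarrow> bool" where
  "quadratic F \<longleftrightarrow> (\<exists>c00 c10 c01 c20 c11 c02. \<forall>u z.
     F u z = c00 + c10 * u + c01 * z + c20 * u ^ 2 + c11 * (u * z) + c02 * z ^ 2)"

lemma quadratic_0: "quadratic (\<lambda>u z. 0)"
  unfolding quadratic_def by (intro exI[of _ 0]) simp

lemma quadratic_add:
  assumes "quadratic F" "quadratic G"
  shows "quadratic (\<lambda>u z. F u z + G u z)"
proof -
  from assms(1) obtain c00 c10 c01 c20 c11 c02 where F: "\<And>u z.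
     F u z = c00 + c10 * u + c01 * z + c20 * u ^ 2 + c11 * (u * z) + c02 * z ^ 2"
    unfolding quadratic_def by blast
  from assms(2) obtain d00 d10 d01 d20 d11 d02 where G: "\<And>u z.
     G u z = d00 + d10 * u + d01 * z + d20 * u ^ 2 + d11 * (u * z) + d02 * z ^ 2"
    unfolding quadratic_def by blast
  show ?thesis
    unfolding quadratic_def F G
    by (intro exI[of _ "c00 + d00"] exI[of _ "c10 + d10"] exI[of _ "c01 + d01"]
        exI[of _ "c20 + d20"] exI[of _ "c11 + d11"] exI[of _ "c02 + d02"])
       (simp add: algebra_simps)
qed

lemma quadratic_monomial:
  assumes "i + j \<le> 2"
  shows "quadratic (\<lambda>u z. c * (u ^ i * z ^ j))"
proof -
  define C where "C k l = (if i = k \<and> j = l then c else 0)" for k l :: nat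
  consider "i = 0" "j = 0" | "i = 1" "j = 0" | "i = 0" "j = 1" | "i = 2" "j = 0" | "i = 1" "j = 1" | "i = 0" "j = 2"
    using assms by linarith
  then have "c * (u ^ i * z ^ j)
      = C 0 0 + C 1 0 * u + C 0 1 * z + C 2 0 * u ^ 2 + C 1 1 * (u * z) + C 0 2 * z ^ 2" for u z
    by cases (simp_all add: C_def)
  then show ?thesis unfolding quadratic_def by blast
qed

text \<open>
The plane spanned by the direction \<open>e\<close> and the axis of the \<open>n\<close>-th coordinate.
\<close>

definition slice_point :: "nat \<Rightarrow> (nat \<Rightarrow> real) \<Rightarrow> real \<Rightarrow> real \<Rightarrow> nat \<Rightarrow> real" where
  "slice_point n e u z = (\<lambda>i. if i = n then z else u * e i)"

lemma quadratic_slice: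
  assumes "tdeg f \<le> 2"
  shows "quadratic (\<lambda>u z. eval_mpoly (slice_point n e u z) f)"
proof -
  have "quadratic (\<lambda>u z. \<Sum>t\<in>A. lookup f t * monomial_value (slice_point n e u z) t)"
    if "finite A" "A \<subseteq> keys f" for A
    using that
  proof (induction A)
    case empty
    show ?case by (simp add: quadratic_0)
  next
    case (insert t A)
    let ?A = "keys t - {n}"
    let ?i = "\<Sum>i\<in>?A. lookup t i" and ?j = "lookup t n"
    let ?c = "\<Prod>i\<in>?A. e i ^ lookup t i"
    have "(\<Sum>i\<in>keys t. lookup t i) = ?i + ?j"
      by (cases "n \<in> keys t") (simp_all add: sum.remove[of _ n] in_keys_iff)
    moreover have "(\<Sum>i\<in>keys t. lookup t i) \<le> 2"
      using monomial_le_tdeg[of t f] insert.prems assms by simp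
    ultimately have le: "?i + ?j \<le> 2" by simp
    have mv: "monomial_value (slice_point n e u z) t = ?c * (u ^ ?i * z ^ ?j)" for u z
    proof -
      have "monomial_value (slice_point n e u z) t
          = (\<Prod>i\<in>insert n ?A. slice_point n e u z i ^ lookup t i)"
        by (rule monomial_value_superset) auto
      also have "\<dots> = z ^ ?j * (\<Prod>i\<in>?A. (u * e i) ^ lookup t i)"
        by (subst prod.insert) (auto simp: slice_point_def intro!: prod.cong)
      also have "(\<Prod>i\<in>?A. (u * e i) ^ lookup t i) = u ^ ?i * ?c"
        by (simp add: power_mult_distrib prod.distrib power_sum)
      finally show ?thesis by simp
    qed
    have "quadratic (\<lambda>u z. lookup f t * monomial_value (slice_point n e u z) t)"
      unfolding mv using quadratic_monomial[OF le, of "lookup f t * ?c"] by (simp add: mult.assoc)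
    with insert show ?case by (simp add: quadratic_add)
  qed
  from this[of "keys f"] show ?thesis
    by (simp add: eval_mpoly_superset[of "keys f"])
qed

text \<open>
Both \<open>k\<close> and \<open>[:f2, f3:]\<close> are quotients of the cubic by a monic quadratic with remainder of
degree at most one, and such a division is unique.
\<close>

lemma cubic_eq_mult_quadratic:
  fixes k :: "real poly"
  assumes "[:f0, f1, f2, f3:] = k * [:C, 0, 1:]"
  shows "f0 = f2 * C" "f1 = f3 * C" "k = [:f2, f3:]"
proof -
  have eq: "(k - [:f2, f3:]) * [:C, 0, 1:] = [:f0 - f2 * C, f1 - f3 * C:]"
    unfolding left_diff_distrib assms[symmetric] by simp
  show k: "k = [:f2, f3:]"
  proof (rule ccontr)
    assume "k \<noteq> [:f2, f3:]"
    then have "degree ((k - [:f2, f3:]) * [:C, 0, 1:]) = degree (k - [:f2, f3:]) + 2"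
      by (subst degree_mult_eq) auto
    moreover have "degree [:f0 - f2 * C, f1 - f3 * C:] \<le> 1" by simp
    ultimately show False unfolding eq by simp
  qed
  from eq show "f0 = f2 * C" "f1 = f3 * C" by (simp_all add: k)
qed

text \<open>
In the plane with coordinates \<open>(u, z)\<close>, where \<open>s = u\<^sup>2\<close>, tangency says that \<open>z\<^sup>2 + C u\<close> with
\<open>C u = (u\<^sup>2 - a\<^sup>2)\<^sup>2 - 1\<close> divides a polynomial that is cubic in \<open>z\<close>.  For every \<open>u\<close> this gives two polynomial identities
in \<open>u\<close>, and their coefficients leave only \<open>E = e11 u z\<close> and the cofactor \<open>2 r02 z\<close> with
\<open>r02 = 2 e11\<close>.  It does not matter how \<open>k\<close> depends on \<open>u\<close>, so the degree of the cofactor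
needs no bound.
\<close>

lemma planar_quadratic_cofactor:
  fixes a :: real and k :: "real \<Rightarrow> real poly"
  assumes E: "quadratic E" and Q: "quadratic Q"
    and eq: "\<And>u z. 4 * (u ^ 2 - a ^ 2) * (u * E u z) + 2 * z * Q u z
                    = poly (k u) z * ((u ^ 2 - a ^ 2) ^ 2 + z ^ 2 - 1)"
    and a: "a > 1"
  shows "4 * (u * E u z) = poly (k u) z * u ^ 2"
proof -
  from E obtain e00 e10 e01 e20 e11 e02 where E': "\<And>u z.
     E u z = e00 + e10 * u + e01 * z + e20 * u ^ 2 + e11 * (u * z) + e02 * z ^ 2"
    unfolding quadratic_def by blast
  from Q obtain r00 r10 r01 r20 r11 r02 where Q': "\<And>u z.
     Q u z = r00 + r10 * u + r01 * z + r20 * u ^ 2 + r11 * (u * z) + r02 * z ^ 2"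
    unfolding quadratic_def by blast
  define C where "C u = (u ^ 2 - a ^ 2) ^ 2 - 1" for u :: real
  define f0 where "f0 u = 4 * (u ^ 2 - a ^ 2) * (u * (e00 + e10 * u + e20 * u ^ 2))" for u
  define f1 where "f1 u = 4 * (u ^ 2 - a ^ 2) * (u * (e01 + e11 * u))
                          + 2 * (r00 + r10 * u + r20 * u ^ 2)" for u
  define f2 where "f2 u = 4 * (u ^ 2 - a ^ 2) * (u * e02) + 2 * (r01 + r11 * u)" for u
  have poly_eq: "[:f0 u, f1 u, f2 u, 2 * r02:] = k u * [:C u, 0, 1:]" for u
  proof (subst poly_eq_poly_eq_iff[symmetric], rule ext)
    fix z
    show "poly [:f0 u, f1 u, f2 u, 2 * r02:] z = poly (k u * [:C u, 0, 1:]) z"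
      using eq[of u z] unfolding E' Q'
      by (simp add: f0_def f1_def f2_def C_def algebra_simps power2_eq_square)
  qed
  note div = cubic_eq_mult_quadratic[OF poly_eq]
  \<comment> \<open>The coefficients of \<open>f0 - f2 C\<close> as a polynomial in \<open>u\<close>.\<close>
  have "[:- 2 * r01 * (a ^ 4 - 1), - 4 * a ^ 2 * e00 - (a ^ 4 - 1) * (2 * r11 - 4 * a ^ 2 * e02),
         - 4 * a ^ 2 * e10 + 4 * a ^ 2 * r01,
         4 * e00 - 4 * a ^ 2 * e20 - 4 * e02 * (a ^ 4 - 1) + 2 * a ^ 2 * (2 * r11 - 4 * a ^ 2 * e02),
         4 * e10 - 2 * r01, 4 * e20 + 12 * a ^ 2 * e02 - 2 * r11, 0, - 4 * e02:] = 0" (is "?P = 0")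
  proof -
    have "poly ?P u = f0 u - f2 u * C u" for u
      by (simp add: f0_def f2_def C_def algebra_simps power2_eq_square power4_eq_xxxx)
    then have "poly ?P u = 0" for u using div(1)[of u] by simp
    then show ?thesis using poly_all_0_iff_0 by blast
  qed
  note coeffs = this
  then have "e02 = 0" by simp
  with coeffs have c: "r01 * (a ^ 4 - 1) = 0" "2 * a ^ 2 * e00 + (a ^ 4 - 1) * r11 = 0"
     "4 * e00 - 4 * a ^ 2 * e20 + 4 * a ^ 2 * r11 = 0" "2 * e10 = r01" "2 * e20 = r11" "e02 = 0"
    by (simp_all add: algebra_simps)
  \<comment> \<open>The coefficients of \<open>f1 - f3 C\<close>, where \<open>f3 = 2 r02\<close>.\<close>
  have "[:2 * r00 - 2 * r02 * (a ^ 4 - 1), 2 * r10 - 4 * a ^ 2 * e01,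
          2 * r20 - 4 * a ^ 2 * e11 + 4 * a ^ 2 * r02, 4 * e01, 4 * e11 - 2 * r02:] = 0" (is "?P = 0")
  proof -
    have "poly ?P u = f1 u - 2 * r02 * C u" for u
      by (simp add: f1_def C_def algebra_simps power2_eq_square power4_eq_xxxx)
    then have "poly ?P u = 0" for u using div(2)[of u] by simp
    then show ?thesis using poly_all_0_iff_0 by blast
  qed
  then have d: "e01 = 0" "2 * e11 = r02" by simp_all
  have "a ^ 4 > 1" using a by simp
  then have "r01 = 0" using c(1) by simp
  have "a ^ 2 * (2 * e20) = a ^ 2 * r11" using c(5) by simp
  then have e00: "2 * e00 = - (a ^ 2 * r11)" using c(3) by linarith
  have "a ^ 2 * (2 * e00) = - (a ^ 4 * r11)"
    unfolding e00 by (simp add: power2_eq_square power4_eq_xxxx)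
  then have "r11 = 0" using c(2) by (simp add: algebra_simps)
  then have "e00 = 0" "e20 = 0" "e10 = 0"
    using e00 c(4,5) \<open>r01 = 0\<close> by simp_all
  then have "E u z = e11 * (u * z)" "f2 u = 0"
    using d c(6) \<open>r01 = 0\<close> \<open>r11 = 0\<close> by (simp_all add: E' f2_def)
  moreover have "poly (k u) z = f2 u + 2 * r02 * z" by (simp add: div(3))
  ultimately show ?thesis using d(2) by (simp add: power2_eq_square algebra_simps)
qed

text \<open>
Every point lies in a plane that contains the axis and is spanned by a unit vector \<open>e\<close>.
In that plane \<open>X(s)\<close> is \<open>2 u\<close> times the component of \<open>X\<close> along \<open>e\<close>, so the planar statement
applies at each point.
\<close>

lemma low_degree_radius_sq_invariant:
  assumes a: "a > 1" and deg: "vf_degree (p + 2) R \<le> 2"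
    and K: "vf_apply (p + 2) R (S_poly p a) = K * S_poly p a"
  shows "2 * vf_apply (p + 2) R (radius_sq p) = K * radius_sq p"
proof (rule mpoly_eqI)
  fix x :: "nat \<Rightarrow> real"
  define \<rho> where "\<rho> = (\<Sum>i = 1..p + 1. x i ^ 2)"
  have goal: "4 * (\<Sum>i = 1..p + 1. x i * eval_mpoly x (R i)) = eval_mpoly x K * \<rho>"
  proof (cases "\<rho> = 0")
    case True
    then have "\<forall>i\<in>{1..p + 1}. x i ^ 2 = 0"
      unfolding \<rho>_def by (subst (asm) sum_nonneg_eq_0_iff) auto
    then have "(\<Sum>i = 1..p + 1. x i * eval_mpoly x (R i)) = 0"
      by (intro sum.neutral) auto
    with True show ?thesis by simp
  next
    case False
    moreover have "\<rho> \<ge> 0" unfolding \<rho>_def by (rule sum_nonneg) auto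
    ultimately have \<rho>: "\<rho> > 0" by simp
    define e where "e i = x i / sqrt \<rho>" for i
    have unit: "(\<Sum>i = 1..p + 1. e i ^ 2) = 1"
    proof -
      have "(\<Sum>i = 1..p + 1. e i ^ 2) = (\<Sum>i = 1..p + 1. x i ^ 2 / \<rho>)"
        using \<rho> by (simp add: e_def power_divide)
      also have "\<dots> = \<rho> / \<rho>" by (simp only: \<rho>_def sum_divide_distrib)
      finally show ?thesis using \<rho> by simp
    qed
    let ?x = "slice_point (p + 2) e"
    define Re where "Re = (\<Sum>i = 1..p + 1. Const (e i) * R i)"
    have "tdeg Re \<le> 2"
      unfolding Re_def
    proof (rule tdeg_sum_le)
      fix i assume "i \<in> {1..p + 1}"
      then have "tdeg (R i) \<le> 2" using tdeg_le_vf_degree[of i "p + 2" R] deg by simp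
      then show "tdeg (Const (e i) * R i) \<le> 2" using tdeg_mult_le[of "Const (e i)" "R i"] by simp
    qed
    then have E: "quadratic (\<lambda>u z. eval_mpoly (?x u z) Re)" by (rule quadratic_slice)
    have "tdeg (R (p + 2)) \<le> 2" using tdeg_le_vf_degree[of "p + 2" "p + 2" R] deg by simp
    then have Q: "quadratic (\<lambda>u z. eval_mpoly (?x u z) (R (p + 2)))" by (rule quadratic_slice)
    define k where "k u = line_poly (?x u 0) (\<lambda>i. if i = p + 2 then 1 else 0) K" for u
    have k: "poly (k u) z = eval_mpoly (?x u z) K" for u z
    proof -
      have "(\<lambda>i. ?x u 0 i + z * (if i = p + 2 then 1 else 0)) = ?x u z"
        by (auto simp: slice_point_def)
      then show ?thesis by (simp add: k_def poly_line_poly)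
    qed
    have low: "?x u z i = u * e i" if "i \<in> {1..p + 1}" for u z i
      using that by (auto simp: slice_point_def)
    have sq: "(\<Sum>i = 1..p + 1. ?x u z i ^ 2) = u ^ 2" for u z
    proof -
      have "(\<Sum>i = 1..p + 1. ?x u z i ^ 2) = (\<Sum>i = 1..p + 1. u ^ 2 * e i ^ 2)"
        by (rule sum.cong[OF refl]) (simp only: low power_mult_distrib)
      then show ?thesis using unit by (simp flip: sum_distrib_left)
    qed
    have T: "(\<Sum>i = 1..p + 1. ?x u z i * eval_mpoly (?x u z) (R i)) = u * eval_mpoly (?x u z) Re" for u z
    proof -
      have "(\<Sum>i = 1..p + 1. ?x u z i * eval_mpoly (?x u z) (R i))
          = (\<Sum>i = 1..p + 1. u * (e i * eval_mpoly (?x u z) (R i)))"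
        by (rule sum.cong[OF refl]) (simp only: low mult.assoc)
      then show ?thesis
        by (simp only: Re_def sum_distrib_left eval_mpoly_sum eval_mpoly_mult eval_mpoly_Const)
    qed
    have top: "?x u z (p + 2) = z" for u z by (simp add: slice_point_def)
    have "4 * (sqrt \<rho> * eval_mpoly (?x (sqrt \<rho>) (x (p + 2))) Re)
        = poly (k (sqrt \<rho>)) (x (p + 2)) * sqrt \<rho> ^ 2"
    proof (rule planar_quadratic_cofactor[OF E Q _ a])
      fix u z
      show "4 * (u ^ 2 - a ^ 2) * (u * eval_mpoly (?x u z) Re) + 2 * z * eval_mpoly (?x u z) (R (p + 2))
          = poly (k u) z * ((u ^ 2 - a ^ 2) ^ 2 + z ^ 2 - 1)"
        using arg_cong[OF K, of "eval_mpoly (?x u z)"]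
        unfolding eval_vf_apply_S_poly eval_mpoly_mult eval_S_poly sq T top k by simp
    qed
    moreover have "?x (sqrt \<rho>) (x (p + 2)) = x"
      using \<rho> by (auto simp: slice_point_def e_def)
    ultimately show ?thesis
      using T[of "sqrt \<rho>" "x (p + 2)"] \<rho> k[of "sqrt \<rho>" "x (p + 2)"] by simp
  qed
  have two: "eval_mpoly x 2 = 2"
    using eval_mpoly_add[of x 1 1] by simp
  show "eval_mpoly x (2 * vf_apply (p + 2) R (radius_sq p)) = eval_mpoly x (K * radius_sq p)"
    using goal unfolding vf_apply_radius_sq eval_mpoly_mult eval_radius_sq \<rho>_def
    by (simp add: two)
qed

text \<open>
Since \<open>h\<close> and \<open>s\<^sup>2\<close> have the same cofactor \<open>K\<close>, so does every member of the pencil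
\<open>h - \<lambda> s\<^sup>2\<close>.  Where \<open>s = 1\<close>, exactly one member passes through each point, so the points at
heights \<open>z = 0, 1, 2, \<dots>\<close> over a fixed point with \<open>s = 1\<close> separate infinitely many members.
\<close>

lemma pencil_infinitely_many_invariant_sets:
  assumes "K \<in> polys (p + 2)"
    and K: "vf_apply (p + 2) R (S_poly p a) = K * S_poly p a"
    and s: "2 * vf_apply (p + 2) R (radius_sq p) = K * radius_sq p"
  shows "infinite (invariant_algebraic_sets (p + 2) R)"
proof -
  define f where "f l = S_poly p a - Const l * radius_sq p ^ 2" for l
  define l where "l k = (1 - a ^ 2) ^ 2 + real k ^ 2 - 1" for k :: nat
  define w where "w k = (\<lambda>i\<in>{1..p + 2}. if i = 1 then 1 else if i = p + 2 then real k else 0)" for k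
  have f_poly: "f l \<in> polys (p + 2)" for l
  proof -
    have "Var (p + 2) \<in> polys (p + 2)" by (rule polys_Var) simp
    then show ?thesis unfolding f_def S_poly_radius_sq using radius_sq_polys by blast
  qed
  have "vf_apply (p + 2) R (f l) = K * f l" for l
  proof -
    have "vf_apply (p + 2) R (f l)
        = K * S_poly p a - Const l * radius_sq p * (2 * vf_apply (p + 2) R (radius_sq p))"
      unfolding f_def vf_apply_diff vf_apply_mult vf_apply_power2 vf_apply_Const K
      by (simp add: algebra_simps)
    also have "\<dots> = K * f l"
      unfolding s by (simp add: f_def algebra_simps power2_eq_square)
    finally show ?thesis .
  qed
  then have sub: "range (\<lambda>k. zero_set (p + 2) (f (l k))) \<subseteq> invariant_algebraic_sets (p + 2) R"
    using f_poly assms(1) unfolding invariant_algebraic_sets_def invariant_poly_def by blast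
  have "(\<Sum>i = 1..p + 1. w k i ^ 2) = 1" for k
  proof -
    have "(\<Sum>i = 1..p + 1. w k i ^ 2) = (\<Sum>i = 1..p + 1. if i = 1 then 1 else 0)"
      by (rule sum.cong) (auto simp: w_def)
    then show ?thesis by simp
  qed
  moreover have "w k (p + 2) = real k" for k by (simp add: w_def)
  ultimately have ev: "eval_mpoly (w k) (f m) = l k - m" for k m
    by (simp add: f_def eval_S_poly eval_radius_sq l_def)
  have "inj (\<lambda>k. zero_set (p + 2) (f (l k)))"
  proof (rule injI)
    fix j k assume eq: "zero_set (p + 2) (f (l j)) = zero_set (p + 2) (f (l k))"
    have "w j \<in> zero_set (p + 2) (f (l j))"
      by (auto simp: zero_set_def ev) (auto simp: w_def)
    then have "l j = l k" unfolding eq by (simp add: zero_set_def ev)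
    then show "j = k" by (simp add: l_def)
  qed
  then show ?thesis using sub finite_subset range_inj_infinite by blast
qed

lemma low_degree_infinitely_many_invariant_sets:
  assumes "a > 1" "vf_on_S p a R" "vf_degree (p + 2) R \<le> 2"
  shows "infinite (invariant_algebraic_sets (p + 2) R)"
proof -
  obtain K where "K \<in> polys (p + 2)" "vf_apply (p + 2) R (S_poly p a) = K * S_poly p a"
    using assms(2) unfolding vf_on_S_def by (auto elim: invariant_polyE)
  then show ?thesis
    using low_degree_radius_sq_invariant[OF assms(1,3)] pencil_infinitely_many_invariant_sets by blast
qed

section \<open>The bound on the multiplicities\<close>

abbreviation level_poly :: "nat \<Rightarrow> real \<Rightarrow> mpoly" where
  "level_poly p d \<equiv> par_poly p 1 d"

lemma eval_par_poly [simp]: "eval_mpoly x (par_poly p \<alpha> c) = \<alpha> * x (p + 2) - c"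
  by (simp add: par_poly_def)

lemma par_poly_normalize: "\<alpha> \<noteq> 0 \<Longrightarrow> par_poly p \<alpha> c = Const \<alpha> * level_poly p (c / \<alpha>)"
  by (rule mpoly_eqI) (simp add: field_simps)

lemma zero_set_par_poly:
  "\<alpha> \<noteq> 0 \<Longrightarrow> zero_set (p + 2) (par_poly p \<alpha> c) = zero_set (p + 2) (level_poly p (c / \<alpha>))"
  by (subst par_poly_normalize) (simp_all add: zero_set_def)

text \<open>
Divisibility does not see the unit \<open>\<alpha>\<close>, so all equations of one plane give the same
multiplicity and \<open>z - c / \<alpha>\<close> may serve as the normal form.
\<close>

lemma par_exponents_normalize:
  assumes "\<alpha> \<noteq> 0"
  shows "par_exponents p R (par_poly p \<alpha> c) = par_exponents p R (level_poly p (c / \<alpha>))"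
proof -
  have inv: "Const \<alpha> ^ k * Const (1 / \<alpha>) ^ k = 1" for k
    by (rule mpoly_eqI) (use assms in \<open>simp flip: power_mult_distrib\<close>)
  have "(Const \<alpha> * g) ^ k dvd f \<longleftrightarrow> g ^ k dvd f" for g f :: mpoly and k
  proof
    assume "(Const \<alpha> * g) ^ k dvd f"
    then show "g ^ k dvd f"
      unfolding power_mult_distrib by (rule dvd_mult_right)
  next
    assume "g ^ k dvd f"
    then obtain h where "f = g ^ k * h" ..
    then have "f = (Const \<alpha> ^ k * Const (1 / \<alpha>) ^ k) * (g ^ k * h)" by (simp add: inv)
    also have "\<dots> = (Const \<alpha> * g) ^ k * (Const (1 / \<alpha>) ^ k * h)"
      by (simp only: power_mult_distrib ac_simps)
    finally show "(Const \<alpha> * g) ^ k dvd f" by simp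
  qed
  then show ?thesis
    unfolding par_exponents_def by (subst par_poly_normalize[OF assms]) simp
qed

text \<open>
For \<open>\<alpha> = 0\<close> the defining polynomial is a nonzero constant, hence a unit, and the
multiplicity is infinite.
\<close>

lemma par_exponents_degenerate:
  assumes "c \<noteq> 0"
  shows "par_exponents p R (par_poly p 0 c) = UNIV"
proof -
  have unit: "par_poly p 0 c * Const (- 1 / c) = 1"
    by (rule mpoly_eqI) (use assms in simp)
  have "f = par_poly p 0 c ^ k * (Const (- 1 / c) ^ k * f)" for k f
    by (simp only: unit power_one mult_1_left flip: power_mult_distrib mult.assoc)
  then have "par_poly p 0 c ^ k dvd f" for k f by (metis dvd_triv_left)
  then show ?thesis by (auto simp: par_exponents_def)
qed

lemma par_mult_eqI:
  assumes "g ^ k dvd R (p + 2)" "\<And>j. g ^ j dvd R (p + 2) \<Longrightarrow> j \<le> k"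
  shows "finite_mult p R g" "par_mult p R g = k"
proof -
  have sub: "par_exponents p R g \<subseteq> {..k}" and mem: "k \<in> par_exponents p R g"
    using assms by (auto simp: par_exponents_def)
  then show "finite_mult p R g" by (auto simp: finite_mult_def dest: finite_subset)
  then show "par_mult p R g = k"
    unfolding par_mult_def finite_mult_def by (rule Max_eqI) (use sub mem in auto)
qed

lemma par_mult_dvd:
  assumes "finite_mult p R g"
  shows "g ^ par_mult p R g dvd R (p + 2)"
proof -
  have "0 \<in> par_exponents p R g" by (simp add: par_exponents_def)
  then have "par_mult p R g \<in> par_exponents p R g"
    unfolding par_mult_def using assms by (intro Max_in) (auto simp: finite_mult_def)
  then show ?thesis by (simp add: par_exponents_def)
qed

lemma line_poly_level_poly:
  assumes "u (p + 2) = 0" "v (p + 2) = 1"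
  shows "line_poly u v (level_poly p d) = [:-d, 1:]"
  using assms by (simp add: poly_eq_poly_eq_iff[symmetric] fun_eq_iff poly_line_poly)

text \<open>
On a line parametrized by the last coordinate, \<open>z - d\<close> restricts to the linear polynomial
with zero \<open>d\<close>.
\<close>

lemma level_multiplicity_le_order:
  assumes "level_poly p d ^ k dvd f" "u (p + 2) = 0" "v (p + 2) = 1" "line_poly u v f \<noteq> 0"
  shows "k \<le> order d (line_poly u v f)"
proof -
  from assms(1) obtain h where "f = level_poly p d ^ k * h" ..
  then have "[:-d, 1:] ^ k dvd line_poly u v f"
    using assms(2,3) by (simp add: line_poly_level_poly)
  then show ?thesis using assms(4) by (simp add: order_divides)
qed

lemma sum_order_le_degree_finite:
  fixes q :: "real poly"
  assumes "q \<noteq> 0" "finite D"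
  shows "(\<Sum>d\<in>D. order d q) \<le> degree q"
proof -
  have "(\<Sum>d\<in>D. order d q) = (\<Sum>d\<in>{d \<in> D. poly q d = 0}. order d q)"
    by (rule sum.mono_neutral_right) (use assms in \<open>auto simp: order_0I\<close>)
  also have "\<dots> \<le> (\<Sum>d | poly q d = 0. order d q)"
    by (rule sum_mono2) (use assms poly_roots_finite in auto)
  also have "\<dots> \<le> degree q" by (rule sum_order_le_degree[OF assms(1)])
  finally show ?thesis .
qed

text \<open>
The strict inequality comes from the axis \<open>s = 0\<close>, where tangency reads
\<open>2 z R = K (z\<^sup>2 + a\<^sup>4 - 1)\<close>.  If \<open>R \<noteq> 0\<close> on the axis, the zeros of \<open>R\<close> other than \<open>0\<close> are zeros
of \<open>K\<close>, whose degree there is one less than that of \<open>R\<close>.  Otherwise \<open>R\<close> vanishes on the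
axis, and a line that joins a point with \<open>R \<noteq> 0\<close> to the axis carries a further zero of \<open>R\<close>.
\<close>

lemma sum_multiplicities_less_tdeg:
  assumes a: "a > 1"
    and K: "vf_apply (p + 2) R (S_poly p a) = K * S_poly p a"
    and nz: "R (p + 2) \<noteq> 0"
    and D: "finite D" "0 \<notin> D"
    and dvd: "\<And>d. d \<in> D \<Longrightarrow> level_poly p d ^ \<mu> d dvd R (p + 2)"
  shows "(\<Sum>d\<in>D. \<mu> d) < tdeg (R (p + 2))"
proof -
  let ?axis = "\<lambda>i. if i = p + 2 then 1 else 0 :: real"
  define q where "q = line_poly (\<lambda>i. 0) ?axis (R (p + 2))"
  define k where "k = line_poly (\<lambda>i. 0) ?axis K"
  define b where "b = a ^ 4 - 1"
  have b: "b > 0" using a by (simp add: b_def)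
  have qk: "[:0, 2:] * q = k * [:b, 0, 1:]"
  proof (subst poly_eq_poly_eq_iff[symmetric], rule ext)
    fix r
    let ?x = "\<lambda>i. 0 + r * ?axis i"
    have sum0: "(\<Sum>i = 1..p + 1. ?x i ^ 2) = 0" "(\<Sum>i = 1..p + 1. ?x i * y i) = 0" for y
      by (rule sum.neutral, simp)+
    have top: "?x (p + 2) = r" by simp
    have "2 * r * eval_mpoly ?x (R (p + 2)) = eval_mpoly ?x K * ((0 - a ^ 2) ^ 2 + r ^ 2 - 1)"
      using arg_cong[OF K, of "eval_mpoly ?x"]
      unfolding eval_vf_apply_S_poly eval_mpoly_mult eval_S_poly sum0 top by simp
    then show "poly ([:0, 2:] * q) r = poly (k * [:b, 0, 1:]) r"
      unfolding q_def k_def poly_mult poly_line_poly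
      by (simp add: b_def power2_eq_square power4_eq_xxxx algebra_simps)
  qed
  show ?thesis
  proof (cases "q = 0")
    case False
    then have k: "k \<noteq> 0" using qk by auto
    have le: "\<mu> d \<le> order d k" if "d \<in> D" for d
    proof -
      have "\<mu> d \<le> order d q"
        using level_multiplicity_le_order[OF dvd[OF that]] False unfolding q_def by simp
      also have "\<dots> = order d ([:0, 2:] * q)"
      proof -
        have "d \<noteq> 0" using D(2) that by auto
        then have "order d [:0, 2:] = 0" by (intro order_0I) simp
        then show ?thesis using False by (subst order_mult) auto
      qed
      also have "\<dots> = order d k"
      proof -
        have "poly [:b, 0, 1:] d > 0" using b by (simp add: add_pos_nonneg)
        then have "order d [:b, 0, 1:] = 0" by (intro order_0I) simp
        moreover have "k * [:b, 0, 1:] \<noteq> 0" using k by (intro no_zero_divisors) auto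
        ultimately show ?thesis unfolding qk by (subst order_mult) auto
      qed
      finally show ?thesis .
    qed
    have "(\<Sum>d\<in>D. \<mu> d) \<le> (\<Sum>d\<in>D. order d k)" by (rule sum_mono) (rule le)
    also have "\<dots> \<le> degree k" by (rule sum_order_le_degree_finite[OF k D(1)])
    also have "degree k < degree q"
      using arg_cong[OF qk, of degree] False k by (subst (asm) (1 2) degree_mult_eq) auto
    also have "degree q \<le> tdeg (R (p + 2))" unfolding q_def by (rule degree_line_poly)
    finally show ?thesis .
  next
    case True
    obtain x where x: "eval_mpoly x (R (p + 2)) \<noteq> 0"
      using nz eval_mpoly_eq_0_imp_eq_0 by blast
    obtain t0 where t0: "t0 \<notin> insert (x (p + 2)) D"
      using ex_new_if_finite[OF infinite_UNIV_char_0, of "insert (x (p + 2)) D"] D(1) by auto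
    \<comment> \<open>The line \<open>r \<mapsto> u + r v\<close> has height \<open>r\<close>, passes through \<open>x\<close> and meets the axis at \<open>t0\<close>.\<close>
    define l where "l = x (p + 2) - t0"
    have l: "l \<noteq> 0" using t0 by (auto simp: l_def)
    define u where "u = (\<lambda>i. if i = p + 2 then 0 else - t0 * x i / l)"
    define v where "v = (\<lambda>i. if i = p + 2 then 1 else x i / l)"
    have uv: "u (p + 2) = 0" "v (p + 2) = 1" by (simp_all add: u_def v_def)
    define h where "h = line_poly u v (R (p + 2))"
    have top: "x (p + 2) = l + t0" by (simp add: l_def)
    have "u i + x (p + 2) * v i = x i" for i
      unfolding top using l by (cases "i = p + 2") (use top in \<open>simp_all add: u_def v_def field_simps\<close>)
    then have "(\<lambda>i. u i + x (p + 2) * v i) = x" by (rule ext)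
    then have "poly h (x (p + 2)) \<noteq> 0" using x by (simp add: h_def poly_line_poly)
    then have h: "h \<noteq> 0" by auto
    have "(\<lambda>i. u i + t0 * v i) = (\<lambda>i. 0 + t0 * ?axis i)"
      by (auto simp: u_def v_def)
    then have "poly h t0 = poly q t0" by (simp only: h_def q_def poly_line_poly)
    then have "order t0 h \<noteq> 0" using True h order_root by auto
    moreover have "\<mu> d \<le> order d h" if "d \<in> D" for d
      using level_multiplicity_le_order[of p d _ _ u v, OF dvd[OF that] uv] h by (simp add: h_def)
    then have "(\<Sum>d\<in>D. \<mu> d) \<le> (\<Sum>d\<in>D. order d h)" by (rule sum_mono)
    ultimately have "(\<Sum>d\<in>D. \<mu> d) < (\<Sum>d\<in>insert t0 D. order d h)"
      using t0 D(1) by simp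
    also have "\<dots> \<le> degree h" by (rule sum_order_le_degree_finite) (use h D in auto)
    also have "degree h \<le> tdeg (R (p + 2))" unfolding h_def by (rule degree_line_poly)
    finally show ?thesis .
  qed
qed

text \<open>
There are at most as many counted pairs as pairs \<open>(d, k)\<close> with \<open>k\<close> below the
multiplicity of \<open>z = d\<close>.  The heights \<open>d = c / \<alpha>\<close> that occur are nonzero because \<open>c > 0\<close>, and the bound on
finite sets of heights shows that only finitely many have positive multiplicity.
\<close>

lemma invariant_parallels_bound:
  assumes a: "a > 1" and vf: "vf_on_S p a R" and nz: "R (p + 2) \<noteq> 0"
  shows "finite (invariant_parallels p R)" "card (invariant_parallels p R) < tdeg (R (p + 2))"
proof -
  obtain K where K: "vf_apply (p + 2) R (S_poly p a) = K * S_poly p a"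
    using vf unfolding vf_on_S_def by (auto elim: invariant_polyE)
  note bound = sum_multiplicities_less_tdeg[OF a K nz]
  define \<mu> where "\<mu> d = par_mult p R (level_poly p d)" for d
  have fin: "finite_mult p R (level_poly p d)" if "d \<noteq> 0" for d
  proof -
    have "par_exponents p R (level_poly p d) \<subseteq> {..<tdeg (R (p + 2))}"
      using bound[of "{d}"] that by (auto simp: par_exponents_def)
    then show ?thesis by (auto simp: finite_mult_def dest: finite_subset)
  qed
  have dvd: "level_poly p d ^ \<mu> d dvd R (p + 2)" if "d \<noteq> 0" for d
    unfolding \<mu>_def by (rule par_mult_dvd[OF fin[OF that]])
  define D where "D = {d. d \<noteq> 0 \<and> 0 < \<mu> d}"
  have "finite D"
  proof (rule conjunct1[OF finite_if_finite_subsets_card_bdd])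
    fix G assume G: "G \<subseteq> D" "finite G"
    have "card G = (\<Sum>d\<in>G. 1)" by simp
    also have "\<dots> \<le> (\<Sum>d\<in>G. \<mu> d)" using G(1) by (intro sum_mono) (auto simp: D_def Suc_le_eq)
    also have "\<dots> \<le> tdeg (R (p + 2))"
      by (rule less_imp_le, rule bound) (use G dvd in \<open>auto simp: D_def\<close>)
    finally show "card G \<le> tdeg (R (p + 2))" .
  qed
  let ?f = "\<lambda>(d, k). (zero_set (p + 2) (level_poly p d), k)"
  have sub: "invariant_parallels p R \<subseteq> ?f ` (SIGMA d:D. {..<\<mu> d})"
  proof
    fix x assume "x \<in> invariant_parallels p R"
    then obtain H k \<alpha> c where x: "x = (H, k)" "0 < c" "H = zero_set (p + 2) (par_poly p \<alpha> c)"
        "finite_mult p R (par_poly p \<alpha> c)" "k < par_mult p R (par_poly p \<alpha> c)"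
      unfolding invariant_parallels_def by blast
    have \<alpha>: "\<alpha> \<noteq> 0"
      using x(2,4) par_exponents_degenerate[of c] by (auto simp: finite_mult_def)
    have "k < \<mu> (c / \<alpha>)"
      using x(5) unfolding \<mu>_def par_mult_def par_exponents_normalize[OF \<alpha>] .
    then have "(c / \<alpha>, k) \<in> (SIGMA d:D. {..<\<mu> d})"
      using x(2) \<alpha> by (auto simp: D_def)
    then show "x \<in> ?f ` (SIGMA d:D. {..<\<mu> d})"
      using x(1,3) zero_set_par_poly[OF \<alpha>] by force
  qed
  have finS: "finite (SIGMA d:D. {..<\<mu> d})" using \<open>finite D\<close> by simp
  show "finite (invariant_parallels p R)" using sub finS by (meson finite_imageI finite_subset)
  have "card (invariant_parallels p R) \<le> card (SIGMA d:D. {..<\<mu> d})"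
    by (rule surj_card_le[OF finS sub])
  also have "\<dots> = (\<Sum>d\<in>D. \<mu> d)" using \<open>finite D\<close> by simp
  also have "\<dots> < tdeg (R (p + 2))"
    by (rule bound) (use \<open>finite D\<close> dvd in \<open>auto simp: D_def\<close>)
  finally show "card (invariant_parallels p R) < tdeg (R (p + 2))" .
qed

lemma invariant_parallels_zero:
  assumes "R (p + 2) = 0"
  shows "invariant_parallels p R = {}"
  using assms by (auto simp: invariant_parallels_def finite_mult_def par_exponents_def)

section \<open>A vector field that attains the bound\<close>

text \<open>
The factor \<open>z\<^sup>2 - 1\<close> of the last component is what tangency along \<open>s = a\<^sup>2\<close> asks for, and
\<open>x\<^sub>1\<close> makes that component vanish on the axis.  The powers of \<open>z - 1\<close> raise the degree and
the multiplicity of \<open>z = 1\<close> together; the exponents are meant for \<open>m \<ge> 3\<close>, where the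
subtractions do not truncate.
\<close>

definition extremal_vf :: "nat \<Rightarrow> real \<Rightarrow> nat \<Rightarrow> nat \<Rightarrow> mpoly" where
  "extremal_vf p a m i =
     (if i = 1 then Const (1 / 2) * Var (p + 2) * level_poly p 1 ^ (m - 3) * (radius_sq p - Const (a ^ 2))
      else if i = p + 2 then level_poly p 1 ^ (m - 2) * level_poly p (-1) * Var 1
      else 0)"

lemma extremal_vf_last: "extremal_vf p a m (p + 2) = level_poly p 1 ^ (m - 2) * level_poly p (-1) * Var 1"
  by (simp add: extremal_vf_def)

lemma par_poly_polys: "par_poly p \<alpha> c \<in> polys (p + 2)"
proof -
  have "Var (p + 2) \<in> polys (p + 2)" by (rule polys_Var) simp
  then show ?thesis unfolding par_poly_def by blast
qed

lemma vf_on_S_extremal_vf: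
  assumes "m \<ge> 3"
  shows "vf_on_S p a (extremal_vf p a m)"
proof -
  have V: "Var 1 \<in> polys (p + 2)" "Var (p + 2) \<in> polys (p + 2)"
    by (rule polys_Var, simp)+
  have "poly_vf (p + 2) (extremal_vf p a m)"
    unfolding poly_vf_def extremal_vf_def
    using V par_poly_polys radius_sq_polys
    by (auto intro!: polys_mult polys_power polys_diff)
  moreover have "vf_apply (p + 2) (extremal_vf p a m) (S_poly p a)
      = (Const 2 * Var (p + 2) * level_poly p 1 ^ (m - 3) * Var 1) * S_poly p a"
  proof (rule mpoly_eqI)
    fix x :: "nat \<Rightarrow> real"
    define s where "s = (\<Sum>i = 1..p + 1. x i ^ 2)"
    have "(\<Sum>i = 1..p + 1. x i * eval_mpoly x (extremal_vf p a m i))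
        = (\<Sum>i = 1..p + 1. if i = 1 then x 1 * eval_mpoly x (extremal_vf p a m 1) else 0)"
      by (rule sum.cong) (auto simp: extremal_vf_def)
    also have "\<dots> = x 1 * eval_mpoly x (extremal_vf p a m 1)" by (subst sum.delta) auto
    also have "\<dots> = x 1 * (1 / 2 * x (p + 2) * (x (p + 2) - 1) ^ (m - 3) * (s - a ^ 2))"
      by (simp add: extremal_vf_def eval_radius_sq s_def)
    finally have T: "(\<Sum>i = 1..p + 1. x i * eval_mpoly x (extremal_vf p a m i))
        = x 1 * (1 / 2 * x (p + 2) * (x (p + 2) - 1) ^ (m - 3) * (s - a ^ 2))" .
    have "m - 2 = Suc (m - 3)" using assms by simp
    then have L: "eval_mpoly x (extremal_vf p a m (p + 2))
        = (x (p + 2) - 1) ^ (m - 3) * (x (p + 2) - 1) * (x (p + 2) + 1) * x 1"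
      unfolding extremal_vf_last by simp
    have alg: "4 * w * (x 1 * (1 / 2 * z * P * w)) + 2 * z * (P * (z - 1) * (z + 1) * x 1)
        = (2 * z * P * x 1) * (w ^ 2 + z ^ 2 - 1)" for z P w
      by (simp add: algebra_simps power2_eq_square)
    show "eval_mpoly x (vf_apply (p + 2) (extremal_vf p a m) (S_poly p a))
        = eval_mpoly x ((Const 2 * Var (p + 2) * level_poly p 1 ^ (m - 3) * Var 1) * S_poly p a)"
      unfolding eval_vf_apply_S_poly eval_mpoly_mult eval_S_poly T L s_def[symmetric]
        eval_mpoly_Const eval_mpoly_Var eval_mpoly_power eval_par_poly mult_1_left
      by (rule alg)
  qed
  moreover have "Const 2 * Var (p + 2) * level_poly p 1 ^ (m - 3) * Var 1 \<in> polys (p + 2)"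
    using V par_poly_polys by (intro polys_mult polys_power) auto
  ultimately show ?thesis unfolding vf_on_S_def invariant_poly_def by blast
qed

lemma tdeg_par_poly_le: "tdeg (par_poly p \<alpha> c) \<le> 1"
  unfolding par_poly_def
  using tdeg_mult_le[of "Const \<alpha>" "Var (p + 2)"] by (intro tdeg_diff_le) auto

lemma tdeg_mult_leI: "tdeg f \<le> i \<Longrightarrow> tdeg g \<le> j \<Longrightarrow> i + j \<le> d \<Longrightarrow> tdeg (f * g) \<le> d"
  using tdeg_mult_le[of f g] by simp

lemma tdeg_power_par_poly_le: "tdeg (par_poly p \<alpha> c ^ k) \<le> k"
proof -
  have "tdeg (par_poly p \<alpha> c ^ k) \<le> k * tdeg (par_poly p \<alpha> c)" by (rule tdeg_power_le)
  also have "\<dots> \<le> k * 1" by (rule mult_le_mono2[OF tdeg_par_poly_le])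
  finally show ?thesis by simp
qed

lemma vf_degree_extremal_vf:
  assumes "m \<ge> 3"
  shows "vf_degree (p + 2) (extremal_vf p a m) = m"
  unfolding vf_degree_def
proof (rule Max_eqI)
  have "tdeg (radius_sq p) \<le> 2"
    unfolding radius_sq_def by (rule tdeg_sum_le) (use tdeg_power_le[of "Var _" 2] in simp)
  then have 2: "tdeg (radius_sq p - Const (a ^ 2)) \<le> 2" by (intro tdeg_diff_le) auto
  have first: "tdeg (extremal_vf p a m 1) \<le> m"
  proof -
    have "tdeg (Const (1 / 2) * Var (p + 2)) \<le> 1"
      by (rule tdeg_mult_leI[of _ 0 _ 1]) auto
    then have "tdeg (Const (1 / 2) * Var (p + 2) * level_poly p 1 ^ (m - 3)) \<le> m - 2"
      by (rule tdeg_mult_leI[OF _ tdeg_power_par_poly_le]) (use assms in simp)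
    then have "tdeg (Const (1 / 2) * Var (p + 2) * level_poly p 1 ^ (m - 3)
        * (radius_sq p - Const (a ^ 2))) \<le> m"
      by (rule tdeg_mult_leI[OF _ 2]) (use assms in simp)
    then show ?thesis by (simp add: extremal_vf_def)
  qed
  have last: "tdeg (extremal_vf p a m (p + 2)) \<le> m"
  proof -
    have "tdeg (level_poly p 1 ^ (m - 2) * level_poly p (-1)) \<le> m - 1"
      by (rule tdeg_mult_leI[OF tdeg_power_par_poly_le tdeg_par_poly_le]) (use assms in simp)
    then show ?thesis
      unfolding extremal_vf_last by (rule tdeg_mult_leI[where j = 1]) (use assms in auto)
  qed
  show "d \<le> m" if d: "d \<in> (\<lambda>i. tdeg (extremal_vf p a m i)) ` {1..p + 2}" for d
  proof -
    from d obtain i where "d = tdeg (extremal_vf p a m i)" by blast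
    then show ?thesis
      using first last by (cases "i = 1 \<or> i = p + 2") (auto simp: extremal_vf_def)
  qed
  have "line_poly (\<lambda>i. 0) (\<lambda>i. 1) (extremal_vf p a m (p + 2)) = [:-1, 1:] ^ (m - 2) * [:1, 1:] * [:0, 1:]"
    unfolding extremal_vf_last
    by (simp add: poly_eq_poly_eq_iff[symmetric] fun_eq_iff poly_line_poly algebra_simps)
  moreover have "degree ([:-1, 1:] ^ (m - 2) * [:1, 1:] * [:0, 1::real:]) = m"
    using assms
    by (simp add: degree_mult_eq degree_power_eq del: mult_pCons_left mult_pCons_right)
  ultimately have "m \<le> tdeg (extremal_vf p a m (p + 2))"
    using degree_line_poly[of "\<lambda>i. 0" "\<lambda>i. 1" "extremal_vf p a m (p + 2)"] by simp
  with last have "tdeg (extremal_vf p a m (p + 2)) = m" by simp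
  then show "m \<in> (\<lambda>i. tdeg (extremal_vf p a m i)) ` {1..p + 2}"
    by (intro image_eqI[of _ _ "p + 2"]) auto
qed simp

text \<open>
Seen on the vertical line \<open>x\<^sub>1 = 1\<close>, where the last component becomes
\<open>(z - 1) ^ (m - 2) * (z + 1)\<close>.
\<close>

lemma extremal_vf_multiplicity:
  assumes "level_poly p d ^ k dvd extremal_vf p a m (p + 2)"
  shows "k \<le> (if d = 1 then m - 2 else if d = -1 then 1 else 0)"
proof -
  define q where "q = [:-1, 1:] ^ (m - 2) * [:1, 1::real:]"
  have q: "line_poly (\<lambda>i. if i = 1 then 1 else 0) (\<lambda>i. if i = p + 2 then 1 else 0)
      (extremal_vf p a m (p + 2)) = q"
    unfolding extremal_vf_last q_def
    by (simp add: poly_eq_poly_eq_iff[symmetric] fun_eq_iff poly_line_poly algebra_simps)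
  have nz: "q \<noteq> 0" unfolding q_def by (simp del: mult_pCons_right)
  have "k \<le> order d q"
    using level_multiplicity_le_order[OF assms, of "\<lambda>i. if i = 1 then 1 else 0"
        "\<lambda>i. if i = p + 2 then 1 else 0"] q nz by simp
  also have "order d q = (if d = 1 then m - 2 else if d = -1 then 1 else 0)"
  proof -
    have "order d q = order d ([:-1, 1:] ^ (m - 2)) + order d [:1, 1:]"
      using order_mult[OF nz[unfolded q_def]] unfolding q_def .
    moreover have "order d ([:-1, 1:] ^ (m - 2)) = (if d = 1 then m - 2 else 0)"
      using order_power_n_n[of 1 "m - 2"] by (auto intro: order_0I)
    moreover have "order d [:1, 1:] = (if d = -1 then 1 else 0)"
      using order_power_n_n[of "-1::real" 1] by (auto intro: order_0I)
    ultimately show ?thesis by auto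
  qed
  finally show ?thesis .
qed

lemma extremal_vf_par_mult:
  shows "finite_mult p (extremal_vf p a m) (level_poly p d)"
    and "par_mult p (extremal_vf p a m) (level_poly p d) = (if d = 1 then m - 2 else if d = -1 then 1 else 0)"
proof -
  let ?k = "if d = 1 then m - 2 else if d = -1 then 1 else 0"
  have "level_poly p d ^ ?k dvd extremal_vf p a m (p + 2)"
    unfolding extremal_vf_last by (auto intro: dvd_mult dvd_mult2)
  from par_mult_eqI[where R = "extremal_vf p a m" and p = p, OF this extremal_vf_multiplicity[of p d _ a m]]
  show "finite_mult p (extremal_vf p a m) (level_poly p d)"
    and "par_mult p (extremal_vf p a m) (level_poly p d) = ?k" by blast+
qed

lemma invariant_parallels_extremal_vf:
  assumes "m \<ge> 3"
  shows "invariant_parallels p (extremal_vf p a m)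
    = {zero_set (p + 2) (level_poly p 1)} \<times> {..<m - 2} \<union> {zero_set (p + 2) (level_poly p (-1))} \<times> {..<1}"
    (is "?I = ?J")
proof
  let ?Y = "extremal_vf p a m"
  show "?I \<subseteq> ?J"
  proof
    fix x assume "x \<in> ?I"
    then obtain H k \<alpha> c where x: "x = (H, k)" "0 < c" "H = zero_set (p + 2) (par_poly p \<alpha> c)"
        "finite_mult p ?Y (par_poly p \<alpha> c)" "k < par_mult p ?Y (par_poly p \<alpha> c)"
      unfolding invariant_parallels_def by blast
    have \<alpha>: "\<alpha> \<noteq> 0"
      using x(2,4) par_exponents_degenerate[of c] by (auto simp: finite_mult_def)
    have "k < par_mult p ?Y (level_poly p (c / \<alpha>))"
      using x(5) unfolding par_mult_def par_exponents_normalize[OF \<alpha>] .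
    then show "x \<in> ?J"
      unfolding extremal_vf_par_mult(2) x(1,3) zero_set_par_poly[OF \<alpha>] by (auto split: if_splits)
  qed
  have V: "Var 1 \<in> polys (p + 2)" by (rule polys_Var) simp
  \<comment> \<open>The plane \<open>z = d\<close> with \<open>d = 1\<close> or \<open>d = -1\<close> is written as \<open>(d / 2) z = 1 / 2\<close>,
    so that the constant lies strictly between \<open>0\<close> and \<open>1\<close>.\<close>
  have mem: "(zero_set (p + 2) (level_poly p d), k) \<in> ?I"
    if d: "d = 1 \<or> d = -1" and k: "k < par_mult p ?Y (level_poly p d)"
      and Q: "Q \<in> polys (p + 2)" "?Y (p + 2) = Q * level_poly p d" for d k Q
  proof -
    have d2: "d / 2 \<noteq> 0" "1 / 2 / (d / 2) = d" using d by auto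
    have "vf_apply (p + 2) ?Y (par_poly p (d / 2) (1 / 2)) = Const (d / 2) * ?Y (p + 2)"
      by (simp add: par_poly_def vf_apply_Var)
    also have "\<dots> = Q * par_poly p (d / 2) (1 / 2)"
      unfolding par_poly_normalize[OF d2(1)] d2(2) Q(2) by (simp only: ac_simps)
    finally have "invariant_poly (p + 2) ?Y (par_poly p (d / 2) (1 / 2))"
      using Q(1) unfolding invariant_poly_def by blast
    moreover have "par_exponents p ?Y (par_poly p (d / 2) (1 / 2)) = par_exponents p ?Y (level_poly p d)"
      using par_exponents_normalize[OF d2(1), of p ?Y "1 / 2"] unfolding d2(2) .
    moreover have "zero_set (p + 2) (par_poly p (d / 2) (1 / 2)) = zero_set (p + 2) (level_poly p d)"
      using zero_set_par_poly[OF d2(1), of p "1 / 2"] unfolding d2(2) .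
    ultimately show ?thesis
      using k extremal_vf_par_mult(1)[of p a m d]
      unfolding invariant_parallels_def finite_mult_def par_mult_def
      by (intro CollectI case_prodI exI[of _ "d / 2"] exI[of _ "1 / 2"]) auto
  qed
  have one: "(zero_set (p + 2) (level_poly p 1), k) \<in> ?I" if k: "k < m - 2" for k
  proof (rule mem)
    have "m - 2 = Suc (m - 3)" using assms by simp
    then show "?Y (p + 2) = (level_poly p 1 ^ (m - 3) * level_poly p (-1) * Var 1) * level_poly p 1"
      unfolding extremal_vf_last by (simp only: power_Suc ac_simps)
    show "level_poly p 1 ^ (m - 3) * level_poly p (-1) * Var 1 \<in> polys (p + 2)"
      by (intro polys_mult polys_power par_poly_polys V)
  qed (use k in \<open>simp_all add: extremal_vf_par_mult(2)\<close>)
  have minus_one: "(zero_set (p + 2) (level_poly p (-1)), 0) \<in> ?I"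
  proof (rule mem)
    show "?Y (p + 2) = (level_poly p 1 ^ (m - 2) * Var 1) * level_poly p (-1)"
      unfolding extremal_vf_last by (simp only: ac_simps)
    show "level_poly p 1 ^ (m - 2) * Var 1 \<in> polys (p + 2)"
      by (intro polys_mult polys_power par_poly_polys V)
  qed (simp_all add: extremal_vf_par_mult(2))
  show "?J \<subseteq> ?I"
  proof
    fix x assume "x \<in> ?J"
    then consider k where "x = (zero_set (p + 2) (level_poly p 1), k)" "k < m - 2"
      | "x = (zero_set (p + 2) (level_poly p (-1)), 0)"
      by blast
    then show "x \<in> ?I" by cases (use one minus_one in blast)+
  qed
qed

lemma level_meets_S:
  assumes "d ^ 2 = 1"
  shows "parallel p a (zero_set (p + 2) (level_poly p d)) \<noteq> {}"
proof -
  define x where "x = (\<lambda>i\<in>{1..p + 2}. if i = 1 then a else if i = p + 2 then d else 0)"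
  have "(\<Sum>i = 1..p + 1. x i ^ 2) = (\<Sum>i = 1..p + 1. if i = 1 then a ^ 2 else 0)"
    by (rule sum.cong) (auto simp: x_def)
  also have "\<dots> = a ^ 2" by (subst sum.delta) auto
  finally have s: "(\<Sum>i = 1..p + 1. x i ^ 2) = a ^ 2" .
  have z: "x (p + 2) = d" by (simp add: x_def)
  have "x \<in> {1..p + 2} \<rightarrow>\<^sub>E UNIV" by (auto simp: x_def)
  moreover have "eval_mpoly x (S_poly p a) = 0" unfolding eval_S_poly s z using assms by simp
  moreover have "eval_mpoly x (level_poly p d) = 0" using z by simp
  ultimately have "x \<in> parallel p a (zero_set (p + 2) (level_poly p d))"
    unfolding parallel_def S_surface_def zero_set_def by blast
  then show ?thesis by blast
qed

lemma level_sets_distinct: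
  assumes "d \<noteq> e"
  shows "zero_set (p + 2) (level_poly p d) \<noteq> zero_set (p + 2) (level_poly p e)"
proof -
  have "(\<lambda>i\<in>{1..p + 2}. d) \<in> zero_set (p + 2) (level_poly p d) - zero_set (p + 2) (level_poly p e)"
    using assms by (simp add: zero_set_def)
  then show ?thesis by blast
qed

lemma card_invariant_parallels_extremal_vf:
  assumes "m \<ge> 3"
  shows "card (invariant_parallels p (extremal_vf p a m)) = m - 1"
proof -
  have "card ({A} \<times> {..<j} \<union> {B} \<times> {..<1::nat}) = j + 1" if "A \<noteq> B"
    for A B :: "(nat \<Rightarrow> real) set" and j
    using that by (subst card_Un_disjoint) auto
  moreover have "zero_set (p + 2) (level_poly p 1) \<noteq> zero_set (p + 2) (level_poly p (-1))"
    by (rule level_sets_distinct) simp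
  ultimately have "card (invariant_parallels p (extremal_vf p a m)) = m - 2 + 1"
    unfolding invariant_parallels_extremal_vf[OF assms] by blast
  then show ?thesis using assms by simp
qed

theorem proposition6p2:
  fixes p m :: nat and a :: real and X :: "nat \<Rightarrow> mpoly"
  assumes "p \<ge> 2" and "a > 1"
    and "vf_on_S p a X"
    and "finite (invariant_algebraic_sets (p + 2) X)"
    and "m = vf_degree (p + 2) X"
  shows "(finite (invariant_parallels p X) \<and>
          int (card (invariant_parallels p X)) \<le> int m - 1) \<and>
         (\<exists>Y. vf_on_S p a Y \<and> vf_degree (p + 2) Y = m \<and>
            finite (invariant_parallels p Y) \<and>
            int (card (invariant_parallels p Y)) = int m - 1 \<and>
            (\<forall>(H, k) \<in> invariant_parallels p Y. parallel p a H \<noteq> {}))"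
proof
  have m: "m \<ge> 3"
  proof (rule ccontr)
    assume "\<not> m \<ge> 3"
    then have "vf_degree (p + 2) X \<le> 2" using assms(5) by simp
    from low_degree_infinitely_many_invariant_sets[OF assms(2,3) this] assms(4) show False by blast
  qed
  show "finite (invariant_parallels p X) \<and> int (card (invariant_parallels p X)) \<le> int m - 1"
  proof (cases "X (p + 2) = 0")
    case True
    then show ?thesis using m by (simp add: invariant_parallels_zero)
  next
    case False
    have "tdeg (X (p + 2)) \<le> m" using tdeg_le_vf_degree[of "p + 2" "p + 2" X] assms(5) by simp
    with invariant_parallels_bound[OF assms(2,3) False] show ?thesis by linarith
  qed
  let ?Y = "extremal_vf p a m"
  have "finite (invariant_parallels p ?Y)"
    unfolding invariant_parallels_extremal_vf[OF m] by simp
  moreover have "int (card (invariant_parallels p ?Y)) = int m - 1"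
    unfolding card_invariant_parallels_extremal_vf[OF m] using m by simp
  moreover have "\<forall>(H, k) \<in> invariant_parallels p ?Y. parallel p a H \<noteq> {}"
    unfolding invariant_parallels_extremal_vf[OF m]
    using level_meets_S[of 1 p a] level_meets_S[of "-1" p a] by auto
  ultimately show "\<exists>Y. vf_on_S p a Y \<and> vf_degree (p + 2) Y = m \<and> finite (invariant_parallels p Y) \<and>
      int (card (invariant_parallels p Y)) = int m - 1 \<and>
      (\<forall>(H, k) \<in> invariant_parallels p Y. parallel p a H \<noteq> {})"
    using vf_on_S_extremal_vf[OF m] vf_degree_extremal_vf[OF m] by blast
qed

end
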